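(* Let $G$ be a graph of order $n$ and size $m$ with no isolated vertices, and let $e$ and $p$ be the numbers of end-vertices and penultimate vertices of $G$, respectively. Then $$\gamma_{\times2}(G)\geq\frac{4n-2m+e-p}{3}.$$ Furthermore, equality holds if and only if $G\in\Omega$.
   Context: An end-vertex is a vertex of degree one; a penultimate vertex is a vertex adjacent to an end-vertex. A set $S\subseteq V(G)$ is a double dominating set if $|N[v]\cap S|\geq2$ for every vertex $v$ (with $N[v]$ the closed neighborhood); $\gamma_{\times2}(G)$ is the minimum size of such a set. The family $\Omega$ is defined as follows: take a bipartite graph $H$ with partite sets $X$ and $Y$ such that every vertex of $X$ has degree two; add a set $M$ of new edges forming a matching whose edges join some vertices of $Y$ that have neighbors in $X$; then to each vertex of $Y$ not saturated by $M$ attach at least one new end-vertex (pendant vertex). $\Omega$ is the family of all graphs $G$ obtained in this way. *)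

theory Defs
  imports Complex_Main
begin

definition simple_graph :: "'a set \<Rightarrow> 'a set set \<Rightarrow> bool" where
  "simple_graph V E \<longleftrightarrow> finite V \<and> (\<forall>d\<in>E. d \<subseteq> V \<and> card d = 2)"

definition neighborhood :: "'a set \<Rightarrow> 'a set set \<Rightarrow> 'a \<Rightarrow> 'a set" where
  "neighborhood V E v = {u \<in> V. {u, v} \<in> E}"

definition closed_neighborhood :: "'a set \<Rightarrow> 'a set set \<Rightarrow> 'a \<Rightarrow> 'a set" where
  "closed_neighborhood V E v = insert v (neighborhood V E v)"

definition vertex_degree :: "'a set \<Rightarrow> 'a set set \<Rightarrow> 'a \<Rightarrow> nat" where
  "vertex_degree V E v = card (neighborhood V E v)"

definition no_isolated_vertices :: "'a set \<Rightarrow> 'a set set \<Rightarrow> bool" where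
  "no_isolated_vertices V E \<longleftrightarrow> (\<forall>v\<in>V. vertex_degree V E v \<noteq> 0)"

definition end_vertices :: "'a set \<Rightarrow> 'a set set \<Rightarrow> 'a set" where
  "end_vertices V E = {v \<in> V. vertex_degree V E v = 1}"

definition penultimate_vertices :: "'a set \<Rightarrow> 'a set set \<Rightarrow> 'a set" where
  "penultimate_vertices V E = {v \<in> V. \<exists>u \<in> end_vertices V E. u \<in> neighborhood V E v}"

definition double_dominating_set :: "'a set \<Rightarrow> 'a set set \<Rightarrow> 'a set \<Rightarrow> bool" where
  "double_dominating_set V E S \<longleftrightarrow>
     S \<subseteq> V \<and> (\<forall>v\<in>V. card (closed_neighborhood V E v \<inter> S) \<ge> 2)"

text \<open>The set below is nonempty exactly when \<^term>\<open>V\<close> is itself double dominating, i.e. when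
  the graph has no isolated vertices; only in that case is the minimum meaningful.\<close>

definition double_domination_number :: "'a set \<Rightarrow> 'a set set \<Rightarrow> nat" where
  "double_domination_number V E = Min {card S | S. double_dominating_set V E S}"

definition bipartite_graph :: "'a set \<Rightarrow> 'a set \<Rightarrow> 'a set set \<Rightarrow> bool" where
  "bipartite_graph X Y E \<longleftrightarrow>
     simple_graph (X \<union> Y) E \<and> X \<inter> Y = {} \<and> (\<forall>d\<in>E. \<exists>x\<in>X. \<exists>y\<in>Y. d = {x, y})"

definition matching_on :: "'a set \<Rightarrow> 'a set set \<Rightarrow> bool" where
  "matching_on W M \<longleftrightarrow> simple_graph W M \<and> pairwise disjnt M"

text \<open>\<^term>\<open>F\<close> is the edge set of the bipartite graph \<^term>\<open>H\<close>, the vertices saturated by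
  \<^term>\<open>M\<close> are those in \<^term>\<open>\<Union>M\<close>, \<^term>\<open>L\<close> is the set of all attached pendant vertices, and
  \<^term>\<open>f\<close> sends each of them to the vertex it is attached to. That every unsaturated vertex of
  \<^term>\<open>Y\<close>, and no other vertex, receives at least one pendant vertex is the equation
  \<^term>\<open>f ` L = Y - \<Union>M\<close>. The sets \<^term>\<open>X\<close>, \<^term>\<open>Y\<close> and \<^term>\<open>M\<close> may be empty: stars
  arise from \<^term>\<open>X = {}\<close>.\<close>

definition Omega :: "('a set \<times> 'a set set) set" where
  "Omega = {(X \<union> Y \<union> L, F \<union> M \<union> {{l, f l} | l. l \<in> L}) | X Y F M L f.
     bipartite_graph X Y F \<and>
     (\<forall>x\<in>X. vertex_degree (X \<union> Y) F x = 2) \<and>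
     matching_on {y \<in> Y. neighborhood (X \<union> Y) F y \<noteq> {}} M \<and>
     finite L \<and> L \<inter> (X \<union> Y) = {} \<and>
     f ` L = Y - \<Union>M}"

end

theory Submission
  imports Defs
begin

text \<open>Let \<open>S\<close> be double dominating. Write \<open>d\<^sub>S v\<close> for the number of neighbours of \<open>v\<close> in \<open>S\<close>, and
  \<open>P\<close> for the set of penultimate vertices, so that \<open>P \<subseteq> S\<close>. Splitting the degree sum along \<open>S\<close>
  gives \<open>2m = \<Sum>\<^sub>v\<^sub>\<in>\<^sub>S d\<^sub>S v + 2 \<Sum>\<^sub>v\<^sub>\<notin>\<^sub>S d\<^sub>S v + \<Sum>\<^sub>v\<^sub>\<notin>\<^sub>S (deg v - d\<^sub>S v)\<close>. Here \<open>d\<^sub>S v \<ge> 2\<close> outside \<open>S\<close>,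
  while inside \<open>S\<close> one has \<open>d\<^sub>S v \<ge> 1\<close> and, for penultimate \<open>v\<close>, \<open>d\<^sub>S v\<close> is at least the number
  of end-vertices at \<open>v\<close>; the latter numbers add up to \<open>e\<close>. Hence \<open>2m \<ge> 4(n - |S|) + |S| + e - p\<close>.
  Equality forces all these estimates to be tight, and a set \<open>S\<close> for which they are tight is the
  same thing as a presentation of the graph as a member of \<open>\<Omega>\<close> with \<open>X = V - S\<close>; the only
  choice is which end of a component \<open>K\<^sub>2\<close> belongs to \<open>Y\<close>.\<close>

section \<open>Neighbourhoods, end-vertices and penultimate vertices\<close>

locale finite_simple_graph =
  fixes V :: "'a set" and E :: "'a set set"
  assumes simple: "simple_graph V E"
begin

abbreviation N :: "'a \<Rightarrow> 'a set" where "N \<equiv> neighborhood V E"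
abbreviation Ends :: "'a set" where "Ends \<equiv> end_vertices V E"
abbreviation Pen :: "'a set" where "Pen \<equiv> penultimate_vertices V E"

lemma finite_V: "finite V"
  using simple by (simp add: simple_graph_def)

lemma finite_E: "finite E"
proof (rule finite_subset)
  show "E \<subseteq> Pow V" using simple by (auto simp: simple_graph_def)
qed (simp add: finite_V)

lemma edge_iff: "{u, v} \<in> E \<longleftrightarrow> u \<in> N v"
  using simple by (auto simp: simple_graph_def neighborhood_def)

lemma edgeE:
  assumes "d \<in> E"
  obtains u v where "d = {u, v}" "u \<noteq> v" "u \<in> V" "v \<in> V" "u \<in> N v" "v \<in> N u"
proof -
  obtain u v where uv: "d = {u, v}" "u \<noteq> v"
    using assms simple by (auto simp: simple_graph_def card_2_iff)
  moreover have "u \<in> N v" "v \<in> N u"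
    using assms uv edge_iff[of u v] edge_iff[of v u] by (auto simp: insert_commute)
  ultimately show thesis using that by (auto simp: neighborhood_def)
qed

lemma N_sym: "u \<in> N v \<longleftrightarrow> v \<in> N u"
  using edge_iff[of u v] edge_iff[of v u] by (simp add: insert_commute)

lemma N_irrefl: "v \<notin> N v"
proof
  assume "v \<in> N v"
  then have "{v} \<in> E" using edge_iff[of v v] by simp
  then show False using simple by (auto simp: simple_graph_def)
qed

lemma N_subset: "N v \<subseteq> V"
  by (auto simp: neighborhood_def)

lemma N_imp_V: "u \<in> N v \<Longrightarrow> u \<in> V" "u \<in> N v \<Longrightarrow> v \<in> V"
  using N_subset N_sym by blast+

lemma finite_N: "finite (N v)"
  using N_subset finite_V finite_subset by blast

lemma Ends_subset: "Ends \<subseteq> V" and Pen_subset: "Pen \<subseteq> V"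
  by (auto simp: end_vertices_def penultimate_vertices_def)

lemma Ends_iff: "v \<in> Ends \<longleftrightarrow> (\<exists>u. N v = {u})"
proof
  assume "\<exists>u. N v = {u}"
  then obtain u where u: "N v = {u}" by blast
  then have "v \<in> V" using N_imp_V(2)[of u v] by simp
  then show "v \<in> Ends" using u by (simp add: end_vertices_def vertex_degree_def)
qed (auto simp: end_vertices_def vertex_degree_def card_1_singleton_iff)

lemma Pen_iff: "v \<in> Pen \<longleftrightarrow> N v \<inter> Ends \<noteq> {}"
  using N_imp_V by (auto simp: penultimate_vertices_def)

section \<open>Double counting of degrees\<close>

lemma handshake: "(\<Sum>v\<in>V. card (N v)) = 2 * card E"
proof -
  have "card (N v) = card {d \<in> E. v \<in> d}" if "v \<in> V" for v
  proof (rule bij_betw_same_card)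
    show "bij_betw (\<lambda>u. {u, v}) (N v) {d \<in> E. v \<in> d}"
    proof (rule bij_betw_imageI)
      show "inj_on (\<lambda>u. {u, v}) (N v)" by (auto simp: inj_on_def doubleton_eq_iff)
      show "(\<lambda>u. {u, v}) ` N v = {d \<in> E. v \<in> d}"
      proof
        show "(\<lambda>u. {u, v}) ` N v \<subseteq> {d \<in> E. v \<in> d}" by (auto simp: edge_iff)
        show "{d \<in> E. v \<in> d} \<subseteq> (\<lambda>u. {u, v}) ` N v"
        proof
          fix d assume "d \<in> {d \<in> E. v \<in> d}"
          then show "d \<in> (\<lambda>u. {u, v}) ` N v" by (auto elim!: edgeE)
        qed
      qed
    qed
  qed
  then have "(\<Sum>v\<in>V. card (N v)) = (\<Sum>v\<in>V. card {d \<in> E. v \<in> d})" by simp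
  also have "\<dots> = (\<Sum>d\<in>E. card {v \<in> V. v \<in> d})"
    by (rule sum_multicount_gen[OF finite_V finite_E]) simp
  also have "\<dots> = (\<Sum>d\<in>E. 2)"
  proof (rule sum.cong[OF refl])
    fix d assume "d \<in> E"
    then have "{v \<in> V. v \<in> d} = d" "card d = 2" using simple by (auto simp: simple_graph_def)
    then show "card {v \<in> V. v \<in> d} = 2" by simp
  qed
  finally show ?thesis by simp
qed

lemma sum_card_N_Int_swap:
  assumes "A \<subseteq> V" "B \<subseteq> V"
  shows "(\<Sum>v\<in>A. card (N v \<inter> B)) = (\<Sum>v\<in>B. card (N v \<inter> A))"
proof -
  have fin: "finite A" "finite B" using assms finite_V finite_subset by blast+
  have eq: "N v \<inter> B = {u \<in> B. u \<in> N v}" "N u \<inter> A = {v \<in> A. u \<in> N v}" for u v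
    using N_sym by auto
  show ?thesis unfolding eq
    by (rule sum_multicount_gen[OF fin]) simp
qed

text \<open>Edges between \<open>S\<close> and its complement enter the degree sum from both ends.
  Their count from the side of \<open>S\<close> is rewritten as a count from the side of
  \<open>V - S\<close>, whence the factor 2.\<close>

lemma degree_sum_split:
  assumes "S \<subseteq> V"
  shows "2 * card E = (\<Sum>v\<in>S. card (N v \<inter> S)) + 2 * (\<Sum>v\<in>V - S. card (N v \<inter> S))
     + (\<Sum>v\<in>V - S. card (N v - S))"
proof -
  have split: "card (N v) = card (N v \<inter> S) + card (N v - S)" for v
    using card_Int_Diff[OF finite_N] by blast
  have out: "N v \<inter> (V - S) = N v - S" for v using N_subset by auto
  have "2 * card E = (\<Sum>v\<in>V - S. card (N v)) + (\<Sum>v\<in>S. card (N v))"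
    using handshake sum.subset_diff[OF assms finite_V, of "\<lambda>v. card (N v)"] by simp
  also have "\<dots> = (\<Sum>v\<in>V - S. card (N v \<inter> S)) + (\<Sum>v\<in>V - S. card (N v - S))
      + ((\<Sum>v\<in>S. card (N v \<inter> S)) + (\<Sum>v\<in>S. card (N v \<inter> (V - S))))"
    unfolding out by (simp add: split sum.distrib)
  also have "(\<Sum>v\<in>S. card (N v \<inter> (V - S))) = (\<Sum>v\<in>V - S. card (N v \<inter> S))"
    using assms by (intro sum_card_N_Int_swap) auto
  finally show ?thesis by simp
qed

text \<open>Each end-vertex has one neighbour and is therefore counted once; vertices outside
  \<open>Pen\<close> contribute nothing.\<close>

lemma sum_card_end_neighbours: "(\<Sum>v\<in>Pen. card (N v \<inter> Ends)) = card Ends"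
proof -
  have "(\<Sum>v\<in>Pen. card (N v \<inter> Ends)) = (\<Sum>v\<in>V. card (N v \<inter> Ends))"
    by (rule sum.mono_neutral_left[OF finite_V Pen_subset]) (auto simp: Pen_iff)
  also have "\<dots> = (\<Sum>v\<in>Ends. card (N v \<inter> V))"
    by (rule sum_card_N_Int_swap[OF _ Ends_subset]) simp
  also have "\<dots> = (\<Sum>v\<in>Ends. 1)"
    using N_subset by (intro sum.cong) (auto simp: end_vertices_def vertex_degree_def Int_absorb2)
  finally show ?thesis by simp
qed

section \<open>The lower bound and its slack\<close>

text \<open>The local lower bound for the number of neighbours in \<open>S\<close> of a vertex of a
  double dominating set \<open>S\<close>; such an \<open>S\<close> contains all
  end-vertices.\<close>

definition demand :: "'a \<Rightarrow> nat" where
  "demand v = (if v \<in> Pen then card (N v \<inter> Ends) else 1)"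

definition tight :: "'a set \<Rightarrow> bool" where
  "tight S \<longleftrightarrow> (\<forall>v\<in>S. card (N v \<inter> S) = demand v) \<and>
     (\<forall>v\<in>V - S. N v \<subseteq> S \<and> card (N v \<inter> S) = 2)"

lemma sum_demand:
  assumes "S \<subseteq> V" "Pen \<subseteq> S"
  shows "(\<Sum>v\<in>S. demand v) + card Pen = card S + card Ends"
proof -
  have fin: "finite S" "finite Pen"
    using assms(1) Pen_subset finite_V by (auto intro: finite_subset)
  have "(\<Sum>v\<in>S. demand v) = (\<Sum>v\<in>S - Pen. demand v) + (\<Sum>v\<in>Pen. demand v)"
    using sum.subset_diff[OF assms(2) fin(1)] .
  also have "(\<Sum>v\<in>S - Pen. demand v) = card (S - Pen)" by (simp add: demand_def)
  also have "(\<Sum>v\<in>Pen. demand v) = card Ends"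
    using sum_card_end_neighbours by (simp add: demand_def)
  finally show ?thesis
    using card_Diff_subset[OF fin(2) assms(2)] card_mono[OF fin(1) assms(2)] by simp
qed

text \<open>The left side is the gap in the claimed bound, the right side the total excess over the
  local estimates. Two required neighbours, weighted by 2, subtract
  \<open>4 * (card V - card S)\<close>; the demands subtract
  \<open>card S + card Ends - card Pen\<close>. Together this leaves
  \<open>3 * card S\<close>.\<close>

lemma slack_identity:
  assumes "S \<subseteq> V" "Pen \<subseteq> S"
  shows "2 * int (card E) + 3 * int (card S) + int (card Pen) - 4 * int (card V) - int (card Ends)
     = (\<Sum>v\<in>S. int (card (N v \<inter> S)) - int (demand v))
       + (\<Sum>v\<in>V - S. 2 * (int (card (N v \<inter> S)) - 2) + int (card (N v - S)))"
proof -
  have "(\<Sum>v\<in>V - S. 2 * (int (card (N v \<inter> S)) - 2) + int (card (N v - S)))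
      = 2 * (\<Sum>v\<in>V - S. int (card (N v \<inter> S))) - 4 * int (card (V - S))
        + (\<Sum>v\<in>V - S. int (card (N v - S)))"
    by (simp add: sum.distrib sum_subtractf sum_distrib_left algebra_simps)
  moreover have "int (card (V - S)) = int (card V) - int (card S)"
    using assms finite_V by (simp add: card_Diff_subset finite_subset of_nat_diff card_mono)
  moreover have "(\<Sum>v\<in>S. int (demand v)) + int (card Pen) = int (card S) + int (card Ends)"
    using arg_cong[OF sum_demand[OF assms], of int] by simp
  moreover have "2 * int (card E) = (\<Sum>v\<in>S. int (card (N v \<inter> S)))
      + 2 * (\<Sum>v\<in>V - S. int (card (N v \<inter> S))) + (\<Sum>v\<in>V - S. int (card (N v - S)))"
    using arg_cong[OF degree_sum_split[OF assms(1)], of int] by simp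
  ultimately show ?thesis by (simp add: sum_subtractf)
qed

text \<open>The closed neighbourhood of an end-vertex has only two elements, so both lie in
  \<open>S\<close>. A vertex of \<open>S\<close> counts itself once and still needs one neighbour in
  \<open>S\<close>; a vertex outside \<open>S\<close> needs two.\<close>

lemma double_dominatingD:
  assumes "double_dominating_set V E S"
  shows "S \<subseteq> V" "Ends \<subseteq> S" "Pen \<subseteq> S"
    "v \<in> S \<Longrightarrow> demand v \<le> card (N v \<inter> S)"
    "v \<in> V - S \<Longrightarrow> 2 \<le> card (N v \<inter> S)"
proof -
  have dom: "2 \<le> card (insert v (N v) \<inter> S)" if "v \<in> V" for v
    using assms that by (simp add: double_dominating_set_def closed_neighborhood_def)
  show SV: "S \<subseteq> V" using assms by (simp add: double_dominating_set_def)
  have both: "v \<in> S \<and> u \<in> S" if "N v = {u}" for u v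
  proof -
    have "v \<in> V" using that N_imp_V(2)[of u v] by simp
    then have "2 \<le> card ({v, u} \<inter> S)" using dom[of v] that by simp
    moreover have "v \<noteq> u" using that N_irrefl[of v] by auto
    ultimately show ?thesis by (cases "v \<in> S"; cases "u \<in> S") auto
  qed
  show ES: "Ends \<subseteq> S" using both by (auto simp: Ends_iff)
  show "Pen \<subseteq> S"
  proof
    fix v assume "v \<in> Pen"
    then obtain u where "u \<in> N v" "u \<in> Ends" by (auto simp: Pen_iff)
    then have "N u = {v}" using N_sym[of u v] by (auto simp: Ends_iff)
    then show "v \<in> S" using both by blast
  qed
  show "demand v \<le> card (N v \<inter> S)" if "v \<in> S"
  proof (cases "v \<in> Pen")
    case True
    then show ?thesis using ES finite_N by (auto simp: demand_def intro!: card_mono)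
  next
    case False
    have "2 \<le> card (insert v (N v \<inter> S))" using dom[of v] that SV by auto
    then show ?thesis using False finite_N N_irrefl[of v] by (simp add: demand_def)
  qed
  show "2 \<le> card (N v \<inter> S)" if "v \<in> V - S" using dom[of v] that by simp
qed

text \<open>Every term on the right of the slack identity is nonnegative, so the gap is nonnegative
  and vanishes only if each term does.\<close>

lemma double_dominating_bound:
  assumes "double_dominating_set V E S"
  shows "4 * card V + card Ends \<le> 2 * card E + 3 * card S + card Pen"
    and "4 * card V + card Ends = 2 * card E + 3 * card S + card Pen \<longleftrightarrow> tight S"
proof -
  note D = double_dominatingD[OF assms]
  let ?f = "\<lambda>v. int (card (N v \<inter> S)) - int (demand v)"
  let ?g = "\<lambda>v. 2 * (int (card (N v \<inter> S)) - 2) + int (card (N v - S))"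
  have fin: "finite S" using D(1) finite_V finite_subset by blast
  have f0: "0 \<le> ?f v" if "v \<in> S" for v using D(4)[OF that] by simp
  have g0: "0 \<le> ?g v" if "v \<in> V - S" for v using D(5)[OF that] by simp
  have F: "0 \<le> sum ?f S" and G: "0 \<le> sum ?g (V - S)"
    using f0 g0 by (auto intro!: sum_nonneg)
  note id = slack_identity[OF D(1,3)]
  show "4 * card V + card Ends \<le> 2 * card E + 3 * card S + card Pen"
    using id F G by linarith
  have "4 * card V + card Ends = 2 * card E + 3 * card S + card Pen
      \<longleftrightarrow> sum ?f S = 0 \<and> sum ?g (V - S) = 0"
    using id F G by linarith
  also have "\<dots> \<longleftrightarrow> (\<forall>v\<in>S. ?f v = 0) \<and> (\<forall>v\<in>V - S. ?g v = 0)"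
    using sum_nonneg_eq_0_iff[OF fin, of ?f] f0
      sum_nonneg_eq_0_iff[of "V - S" ?g] g0 finite_V by simp
  also have "(\<forall>v\<in>V - S. ?g v = 0) \<longleftrightarrow> (\<forall>v\<in>V - S. N v \<subseteq> S \<and> card (N v \<inter> S) = 2)"
  proof (rule ball_cong[OF refl])
    fix v assume v: "v \<in> V - S"
    have "card (N v - S) = 0 \<longleftrightarrow> N v \<subseteq> S" using finite_N by auto
    moreover have "?g v = 0 \<longleftrightarrow> card (N v - S) = 0 \<and> card (N v \<inter> S) = 2"
      using D(5)[OF v] by auto
    ultimately show "?g v = 0 \<longleftrightarrow> N v \<subseteq> S \<and> card (N v \<inter> S) = 2" by simp
  qed
  finally show "4 * card V + card Ends = 2 * card E + 3 * card S + card Pen \<longleftrightarrow> tight S"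
    by (simp add: tight_def)
qed

section \<open>From a tight set to a presentation in \<open>Omega\<close>\<close>

lemma tight_in_Omega:
  assumes dom: "double_dominating_set V E S" and tight: "tight S"
  shows "(V, E) \<in> Omega"
proof -
  note D = double_dominatingD[OF dom]
  \<comment> \<open>In a component \<open>K2\<close> both vertices have the same closed
    neighbourhood, and the choice depends only on that set, so they receive the same
    representative.\<close>
  define rep where "rep v = (SOME u. u \<in> insert v (N v))" for v
  \<comment> \<open>One vertex from each component \<open>K\<^sub>2\<close>, the components whose vertices are both end-vertices
    and penultimate.\<close>
  define C where "C = rep ` (Ends \<inter> Pen)"
  define f where "f l = (THE u. N l = {u})" for l
  define X where "X = V - S"
  \<comment> \<open>In a component \<open>K2\<close> the representative stays in \<open>Y\<close>
    and its partner becomes the pendant vertex attached to it.\<close>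
  define L where "L = Ends - C"
  define Y where "Y = S - L"
  define F where "F = {d \<in> E. d \<inter> X \<noteq> {}}"
  define M where "M = {d \<in> E. d \<subseteq> S - Pen - Ends}"
  have Nf: "N l = {f l}" if "l \<in> Ends" for l
    using that by (auto simp: Ends_iff f_def)
  have f_Pen: "f l \<in> Pen" if "l \<in> Ends" for l
    using Nf[OF that] that N_sym[of "f l" l] by (auto simp: Pen_iff)
  have f_swap: "f (f l) = l" if "l \<in> Ends" "f l \<in> Ends" for l
    using Nf[OF that(1)] Nf[OF that(2)] N_sym[of "f l" l] by auto
  have K2: "f v \<in> Ends" if "v \<in> Ends" "v \<in> Pen" for v
    using that Nf[of v] by (auto simp: Pen_iff)
  have rep_eq: "rep (f v) = rep v" if "v \<in> Ends" "f v \<in> Ends" for v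
    using Nf[OF that(1)] Nf[OF that(2)] f_swap[OF that] by (simp add: rep_def insert_commute)
  have rep_cases: "rep v = v \<or> rep v = f v" if "v \<in> Ends" for v
  proof -
    have "rep v \<in> insert v (N v)" unfolding rep_def by (rule someI[of _ v]) simp
    then show ?thesis using Nf[OF that] by simp
  qed
  have C_K: "C \<subseteq> Ends \<inter> Pen"
    using rep_cases K2 f_Pen unfolding C_def by (metis (no_types, lifting) IntE IntI image_subsetI)
  have C_rep: "rep v = v" if v: "v \<in> C" for v
  proof -
    obtain w where w: "w \<in> Ends" "w \<in> Pen" "v = rep w" using v by (auto simp: C_def)
    then show ?thesis using rep_cases[OF w(1)] rep_eq[OF w(1) K2[OF w(1,2)]] by auto
  qed
  have C_one: "v \<in> C \<longleftrightarrow> f v \<notin> C" if v: "v \<in> Ends" "f v \<in> Ends" for v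
  proof -
    have "v \<in> Pen" using f_Pen[OF v(2)] f_swap[OF v] by simp
    then have inC: "rep v \<in> C" using v by (simp add: C_def)
    have ne: "f v \<noteq> v" using Nf[OF v(1)] N_irrefl[of v] by auto
    show ?thesis using inC rep_cases[OF v(1)] C_rep[of v] C_rep[of "f v"] rep_eq[OF v] ne by metis
  qed
  have X_N: "N x \<subseteq> S" "card (N x) = 2" if "x \<in> X" for x
    using tight that by (auto simp: tight_def X_def dest!: bspec[where x = x] simp: Int_absorb2)
  \<comment> \<open>Since \<open>Ends\<close> lies in \<open>S\<close>, one inclusion is clear, and
    tightness makes the cardinalities equal. So inside \<open>S\<close> a penultimate vertex sees
    only end-vertices.\<close>
  have Pen_N: "N v \<inter> S = N v \<inter> Ends" if "v \<in> Pen" for v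
  proof (rule card_subset_eq[symmetric])
    show "card (N v \<inter> Ends) = card (N v \<inter> S)"
      using tight that D(3) by (auto simp: tight_def demand_def)
  qed (use D(2) finite_N in auto)
  have N_one: "\<exists>w. N v \<inter> S = {w}" if "v \<in> S" "v \<notin> Pen" for v
    using tight that by (auto simp: tight_def demand_def card_1_singleton_iff)
  have LE: "L \<subseteq> Ends" by (auto simp: L_def)
  have Y_Ends: "Y \<inter> Ends \<subseteq> C" by (auto simp: Y_def L_def)
  have V_eq: "V = X \<union> Y \<union> L" using D(1,2) LE by (auto simp: X_def Y_def)
  have f_Y: "f l \<in> Y" if "l \<in> L" for l
    using that LE f_Pen[of l] C_one[of l] D(3) by (auto simp: Y_def L_def)
  have N_X: "N x \<subseteq> Y" if "x \<in> X" for x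
  proof
    fix y assume y: "y \<in> N x"
    have "y \<notin> Ends"
    proof
      assume "y \<in> Ends"
      then have "x \<in> Pen" using y by (auto simp: Pen_iff)
      then show False using that D(3) by (auto simp: X_def)
    qed
    then show "y \<in> Y" using X_N(1)[OF that] y LE by (auto simp: Y_def)
  qed
  have F_N: "neighborhood (X \<union> Y) F v = N v \<inter> (if v \<in> X then Y else X)"
    if "v \<in> X \<union> Y" for v
  proof (cases "v \<in> X")
    case True
    have "u \<in> neighborhood (X \<union> Y) F v \<longleftrightarrow> u \<in> N v \<inter> Y" for u
      using True N_X[OF True] by (auto simp: neighborhood_def[of "X \<union> Y"] F_def edge_iff)
    then show ?thesis using True by auto
  next
    case False
    then show ?thesis
      by (auto simp: neighborhood_def[of "X \<union> Y"] F_def edge_iff)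
  qed
  have bip: "bipartite_graph X Y F"
  proof -
    have edge: "\<exists>x\<in>X. \<exists>y\<in>Y. d = {x, y}" if "d \<in> F" for d
    proof -
      have "d \<in> E" "d \<inter> X \<noteq> {}" using that by (auto simp: F_def)
      then obtain x y where "d = {x, y}" "x \<in> X" "y \<in> N x"
        by (auto elim!: edgeE)
      then show ?thesis using N_X by blast
    qed
    have disj: "X \<inter> Y = {}" by (auto simp: X_def Y_def)
    have "simple_graph (X \<union> Y) F"
      unfolding simple_graph_def
    proof (intro conjI ballI)
      show "finite (X \<union> Y)" using V_eq finite_V finite_subset by blast
      fix d assume d: "d \<in> F"
      show "d \<subseteq> X \<union> Y" using edge[OF d] by auto
      show "card d = 2" using d simple by (auto simp: F_def simple_graph_def)
    qed
    then show ?thesis using edge disj by (auto simp: bipartite_graph_def)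
  qed
  have deg: "\<forall>x\<in>X. vertex_degree (X \<union> Y) F x = 2"
    using X_N(2) N_X F_N by (auto simp: vertex_degree_def Int_absorb2)
  \<comment> \<open>Such a vertex has exactly one neighbour in \<open>S\<close>; without a neighbour
    in \<open>X\<close> it would be an end-vertex.\<close>
  have matched_has_X: "N v \<inter> X \<noteq> {}" if v: "v \<in> S - Pen - Ends" for v
  proof
    assume none: "N v \<inter> X = {}"
    then have "N v \<inter> S = N v" using N_subset[of v] by (auto simp: X_def)
    then have "\<exists>w. N v = {w}" using N_one[of v] v by auto
    then show False using v by (auto simp: Ends_iff)
  qed
  have mat: "matching_on {y \<in> Y. neighborhood (X \<union> Y) F y \<noteq> {}} M"
    unfolding matching_on_def
  proof
    show "simple_graph {y \<in> Y. neighborhood (X \<union> Y) F y \<noteq> {}} M"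
      unfolding simple_graph_def
    proof (intro conjI ballI)
      show "finite {y \<in> Y. neighborhood (X \<union> Y) F y \<noteq> {}}"
        using V_eq finite_V finite_subset by (metis (no_types, lifting) finite_Un mem_Collect_eq subsetI)
      fix d assume d: "d \<in> M"
      show "card d = 2" using d simple by (auto simp: M_def simple_graph_def)
      show "d \<subseteq> {y \<in> Y. neighborhood (X \<union> Y) F y \<noteq> {}}"
      proof
        fix y assume "y \<in> d"
        then have y: "y \<in> S - Pen - Ends" using d by (auto simp: M_def)
        then have "y \<in> Y" "y \<notin> X" using LE by (auto simp: Y_def X_def)
        then show "y \<in> {y \<in> Y. neighborhood (X \<union> Y) F y \<noteq> {}}"
          using F_N[of y] matched_has_X[OF y] by simp
      qed
    qed
    \<comment> \<open>Two edges of \<open>M\<close> sharing \<open>v\<close> have their other ends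
      in \<open>N v \<inter> S\<close>, which is a singleton.\<close>
    show "pairwise disjnt M"
    proof (rule pairwiseI)
      fix d d' assume d: "d \<in> M" and d': "d' \<in> M" and ne: "d \<noteq> d'"
      show "disjnt d d'"
      proof (rule ccontr)
        assume "\<not> disjnt d d'"
        then obtain v where v: "v \<in> d" "v \<in> d'" by (auto simp: disjnt_def)
        obtain w where w: "d = {v, w}" "w \<in> N v"
          using d v(1) by (auto simp: M_def elim!: edgeE)
        obtain w' where w': "d' = {v, w'}" "w' \<in> N v"
          using d' v(2) by (auto simp: M_def elim!: edgeE)
        have "v \<in> S" "v \<notin> Pen" "w \<in> S" "w' \<in> S" using d d' w w' by (auto simp: M_def)
        moreover obtain z where "N v \<inter> S = {z}" using N_one calculation by blast
        ultimately have "w \<in> {z}" "w' \<in> {z}" using w(2) w'(2) by blast+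
        then have "w = w'" by simp
        then show False using ne w w' by simp
      qed
    qed
  qed
  have surj: "f ` L = Y - \<Union>M"
  proof
    show "f ` L \<subseteq> Y - \<Union>M" using f_Y f_Pen LE by (auto simp: M_def)
    show "Y - \<Union>M \<subseteq> f ` L"
    proof
      fix y assume y: "y \<in> Y - \<Union>M"
      then have yS: "y \<in> S" by (auto simp: Y_def)
      \<comment> \<open>Otherwise the single neighbour \<open>w\<close> of \<open>y\<close> in
        \<open>S\<close> is not an end-vertex, since \<open>y\<close> is not penultimate, and not
        penultimate, since \<open>y\<close> is not an end-vertex. Then \<open>{w, y}\<close> lies in
        \<open>M\<close> and saturates \<open>y\<close>.\<close>
      have "y \<in> Pen"
      proof (rule ccontr)
        assume nP: "y \<notin> Pen"
        then have nE: "y \<notin> Ends" using y Y_Ends C_K by auto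
        obtain w where w: "w \<in> N y" "w \<in> S" using N_one[OF yS nP] by auto
        have "w \<notin> Ends" using nP w by (auto simp: Pen_iff)
        moreover have "w \<notin> Pen" using Pen_N[of w] w yS nE N_sym[of w y] by auto
        ultimately have "{w, y} \<in> M" using w yS nP nE by (simp add: M_def edge_iff)
        then show False using y by auto
      qed
      then obtain u where u: "u \<in> Ends" "u \<in> N y" by (auto simp: Pen_iff)
      then have fu: "f u = y" using Nf[of u] N_sym[of u y] by auto
      \<comment> \<open>If \<open>u\<close> were a representative, its component would be
        \<open>K2\<close>, and \<open>y\<close>, an end-vertex in \<open>Y\<close>, would be a
        second representative of it.\<close>
      have "u \<notin> C"
      proof
        assume uC: "u \<in> C"
        then have "y \<in> Ends" using C_K K2[of u] fu by auto
        then show False using C_one[of u] u(1) fu uC y Y_Ends by auto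
      qed
      then show "y \<in> f ` L" using u fu by (auto simp: L_def)
    qed
  qed
  have E_eq: "E = F \<union> M \<union> {{l, f l} | l. l \<in> L}"
  proof
    have "{l, f l} \<in> E" if "l \<in> L" for l
      using that LE Nf[of l] N_sym[of l "f l"] by (auto simp: edge_iff)
    then show "F \<union> M \<union> {{l, f l} | l. l \<in> L} \<subseteq> E" by (auto simp: F_def M_def)
    \<comment> \<open>A representative \<open>u\<close> is itself not in \<open>L\<close>, but its
      partner \<open>f u\<close> is, and it yields the same edge.\<close>
    have pend: "\<exists>l\<in>L. {u, f u} = {l, f l}" if u: "u \<in> Ends" for u
    proof (cases "u \<in> C")
      case True
      then have "f u \<in> Ends" using C_K K2 by auto
      then have "f u \<in> L" "f (f u) = u" using True u C_one[of u] f_swap by (auto simp: L_def)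
      then show ?thesis by (metis insert_commute)
    next
      case False
      then show ?thesis using u by (auto simp: L_def)
    qed
    show "E \<subseteq> F \<union> M \<union> {{l, f l} | l. l \<in> L}"
    proof
      fix d assume dE: "d \<in> E"
      then obtain u v where uv: "d = {u, v}" "u \<in> V" "v \<in> V" "u \<in> N v" "v \<in> N u"
        by (auto elim!: edgeE)
      consider "d \<inter> X \<noteq> {}" | "u \<in> Ends" | "v \<in> Ends" | "d \<inter> X = {}" "u \<notin> Ends" "v \<notin> Ends"
        by blast
      then show "d \<in> F \<union> M \<union> {{l, f l} | l. l \<in> L}"
      proof cases
        case 1
        then show ?thesis using dE by (simp add: F_def)
      next
        case 2
        then have "d = {u, f u}" using Nf[of u] uv by auto
        then show ?thesis using pend[OF 2] by auto
      next
        case 3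
        then have "d = {v, f v}" using Nf[of v] uv by auto
        then show ?thesis using pend[OF 3] by auto
      next
        case 4
        then have S: "u \<in> S" "v \<in> S" using uv by (auto simp: X_def)
        \<comment> \<open>By \<open>Pen_N\<close> a penultimate end of an edge inside
          \<open>S\<close> would force the other end to be an end-vertex.\<close>
        then have "u \<notin> Pen" "v \<notin> Pen" using Pen_N[of u] Pen_N[of v] uv 4 by auto
        then show ?thesis using dE uv(1) S 4 by (auto simp: M_def)
      qed
    qed
  qed
  have "finite L" "L \<inter> (X \<union> Y) = {}"
    using LE D(2) Ends_subset finite_V by (auto simp: X_def Y_def intro: finite_subset)
  then show ?thesis
    using bip deg mat surj E_eq V_eq unfolding Omega_def by blast
qed

section \<open>From a presentation in \<open>Omega\<close> to a tight set\<close>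

text \<open>The set is \<open>Y \<union> L\<close>. Inside it a saturated vertex sees only its
  partner in \<open>M\<close>, an unsaturated vertex of \<open>Y\<close> only its pendant vertices,
  and a pendant vertex only its support; the vertices of \<open>X\<close> keep their two neighbours
  in \<open>Y\<close>.\<close>

lemma Omega_imp_tight:
  assumes "(V, E) \<in> Omega"
  obtains S where "double_dominating_set V E S" "tight S"
proof -
  obtain X Y F M L f where V_eq: "V = X \<union> Y \<union> L"
    and E_eq: "E = F \<union> M \<union> {{l, f l} | l. l \<in> L}"
    and bip: "bipartite_graph X Y F"
    and deg: "\<forall>x\<in>X. vertex_degree (X \<union> Y) F x = 2"
    and mat: "matching_on {y \<in> Y. neighborhood (X \<union> Y) F y \<noteq> {}} M"
    and L: "finite L" "L \<inter> (X \<union> Y) = {}"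
    and surj: "f ` L = Y - \<Union>M"
    using assms unfolding Omega_def by blast
  define S where "S = Y \<union> L"
  have E_iff: "d \<in> E \<longleftrightarrow> d \<in> F \<or> d \<in> M \<or> (\<exists>l\<in>L. d = {l, f l})" for d
    unfolding E_eq by auto
  have XY: "X \<inter> Y = {}" and F_edge: "\<And>d. d \<in> F \<Longrightarrow> \<exists>x\<in>X. \<exists>y\<in>Y. d = {x, y}"
    using bip by (auto simp: bipartite_graph_def)
  have M_sub: "\<And>d. d \<in> M \<Longrightarrow> d \<subseteq> Y \<and> card d = 2"
    and M_F: "\<And>y. y \<in> \<Union>M \<Longrightarrow> neighborhood (X \<union> Y) F y \<noteq> {}"
    and M_disj: "\<And>d d'. d \<in> M \<Longrightarrow> d' \<in> M \<Longrightarrow> d \<noteq> d' \<Longrightarrow> d \<inter> d' = {}"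
    using mat by (auto simp: matching_on_def simple_graph_def pairwise_def disjnt_def)
  have fL: "f l \<in> Y" "f l \<notin> \<Union>M" if "l \<in> L" for l using surj that by auto
  \<comment> \<open>Matching edges lie within \<open>Y\<close> and pendant edges join
    \<open>L\<close> to \<open>Y\<close>, so only edges of \<open>F\<close> meet
    \<open>X\<close>.\<close>
  have F_iff: "{u, v} \<in> F \<longleftrightarrow> u \<in> N v" if "v \<in> X \<union> Y" "u \<in> X" for u v
  proof -
    have "{u, v} \<notin> M" using M_sub that XY by auto
    moreover have "{u, v} \<noteq> {l, f l}" if "l \<in> L" for l
      using that \<open>v \<in> X \<union> Y\<close> \<open>u \<in> X\<close> L(2) by (auto simp: doubleton_eq_iff)
    ultimately show ?thesis by (auto simp: edge_iff[symmetric] E_iff)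
  qed
  have X_N: "N x = neighborhood (X \<union> Y) F x" if x: "x \<in> X" for x
  proof (rule set_eqI)
    fix u
    show "u \<in> N x \<longleftrightarrow> u \<in> neighborhood (X \<union> Y) F x"
    proof (cases "u \<in> X \<union> Y")
      case True
      then show ?thesis using F_iff[of u x] x N_sym[of u x]
        by (simp add: neighborhood_def[of "X \<union> Y"] insert_commute)
    next
      case False
      have "u \<notin> N x"
      proof
        assume "u \<in> N x"
        then have "{u, x} \<in> E" by (simp add: edge_iff)
        then show False
          using False x XY L(2) fL F_edge[of "{u, x}"] M_sub[of "{u, x}"]
          unfolding E_iff by (auto simp: doubleton_eq_iff)
      qed
      then show ?thesis using False by (auto simp: neighborhood_def)
    qed
  qed
  have X_NY: "N x \<subseteq> Y" if x: "x \<in> X" for x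
  proof
    fix u assume "u \<in> N x"
    then have "{u, x} \<in> F" using X_N[OF x] by (simp add: neighborhood_def[of "X \<union> Y"])
    then show "u \<in> Y" using F_edge[of "{u, x}"] x XY by (auto simp: doubleton_eq_iff)
  qed
  have X_card: "card (N x) = 2" if "x \<in> X" for x
    using deg X_N that by (simp add: vertex_degree_def)
  have X_nEnd: "x \<notin> Ends" if "x \<in> X" for x
    using X_card[OF that] by (auto simp: Ends_iff)
  have L_N: "N l = {f l}" if l: "l \<in> L" for l
  proof (rule set_eqI)
    fix u
    have "{u, l} \<in> E \<longleftrightarrow> (\<exists>l'\<in>L. {u, l} = {l', f l'})"
      using l L(2) F_edge[of "{u, l}"] M_sub[of "{u, l}"] unfolding E_iff
      by (auto simp: doubleton_eq_iff)
    also have "\<dots> \<longleftrightarrow> u = f l"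
      using l L(2) fL by (auto simp: doubleton_eq_iff)
    finally show "u \<in> N l \<longleftrightarrow> u \<in> {f l}" by (simp add: edge_iff)
  qed
  have L_Ends: "L \<subseteq> Ends" using L_N by (auto simp: Ends_iff)
  have Y_nF: "{u, y} \<notin> F" if "y \<in> Y" "u \<in> S" for u y
    using that F_edge[of "{u, y}"] XY L(2) by (auto simp: S_def doubleton_eq_iff)
  have unsat_N: "N y \<inter> S = {l \<in> L. f l = y}" if y: "y \<in> Y - \<Union>M" for y
  proof (rule set_eqI)
    fix u
    have "{u, y} \<in> E \<longleftrightarrow> (\<exists>l\<in>L. {u, y} = {l, f l})" if "u \<in> S"
      using y that Y_nF[of y u] unfolding E_iff by auto
    then show "u \<in> N y \<inter> S \<longleftrightarrow> u \<in> {l \<in> L. f l = y}"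
      using y L(2) by (auto simp: edge_iff S_def doubleton_eq_iff)
  qed
  have sat_N: "\<exists>w. N y \<inter> S = {w} \<and> w \<in> \<Union>M" if y: "y \<in> \<Union>M" for y
  proof -
    obtain d where d: "d \<in> M" "y \<in> d" using y by blast
    obtain w where w: "d = {w, y}" "w \<noteq> y"
      using M_sub[OF d(1)] d(2) by (auto simp: card_2_iff)
    have yY: "y \<in> Y" "w \<in> Y" using M_sub[OF d(1)] w by auto
    have "u \<in> N y \<inter> S \<longleftrightarrow> u = w" for u
    proof
      assume u: "u \<in> N y \<inter> S"
      then have "{u, y} \<in> E" by (simp add: edge_iff)
      then have "{u, y} \<in> M" using u yY Y_nF[of y u] y L(2) fL
        unfolding E_iff by (auto simp: doubleton_eq_iff)
      then have "{u, y} = d" using M_disj[of "{u, y}" d] d by auto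
      then show "u = w" using w by (auto simp: doubleton_eq_iff)
    next
      assume "u = w"
      then have "{u, y} \<in> E" using d(1) w unfolding E_iff by auto
      then show "u \<in> N y \<inter> S" using \<open>u = w\<close> yY by (auto simp: edge_iff S_def)
    qed
    then have "N y \<inter> S = {w}" by auto
    then show ?thesis using d w by auto
  qed
  \<comment> \<open>A saturated vertex has its partner in \<open>M\<close> and also a neighbour in
    \<open>X\<close>, because \<open>M\<close> joins only vertices with neighbours in
    \<open>H\<close>.\<close>
  have sat_nEnd: "y \<notin> Ends" if y: "y \<in> \<Union>M" for y
  proof
    assume "y \<in> Ends"
    then obtain u where u: "N y = {u}" by (auto simp: Ends_iff)
    have yY: "y \<in> Y" using y M_sub by auto
    obtain x where x: "{x, y} \<in> F" using M_F[OF y] by (auto simp: neighborhood_def)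
    then have "x \<in> X" using F_edge[OF x] yY XY by (auto simp: doubleton_eq_iff)
    moreover have "x \<in> N y" using x by (auto simp: edge_iff[symmetric] E_iff)
    ultimately show False using u sat_N[OF y] XY L(2) by (auto simp: S_def)
  qed
  \<comment> \<open>Its neighbours are vertices of \<open>X\<close>, of degree two, and its
    saturated partner; none is an end-vertex, so its demand is 1.\<close>
  have sat_nPen: "y \<notin> Pen" if y: "y \<in> \<Union>M" for y
  proof -
    have "u \<notin> Ends" if u: "u \<in> N y" for u
    proof (cases "u \<in> X")
      case False
      then have "u \<in> N y \<inter> S" using u N_imp_V(1)[OF u] V_eq by (auto simp: S_def)
      moreover obtain w where "N y \<inter> S = {w}" "w \<in> \<Union>M" using sat_N[OF y] by blast
      ultimately show ?thesis using sat_nEnd by auto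
    qed (use X_nEnd in auto)
    then show ?thesis by (auto simp: Pen_iff)
  qed
  have dem: "card (N v \<inter> S) = demand v \<and> N v \<inter> S \<noteq> {}" if v: "v \<in> S" for v
  proof -
    consider "v \<in> \<Union>M" | "v \<in> Y - \<Union>M" | "v \<in> L" using v by (auto simp: S_def)
    then show ?thesis
    proof cases
      case 1
      then show ?thesis using sat_N[OF 1] sat_nPen[OF 1] by (auto simp: demand_def)
    next
      case 2
      have "v \<in> f ` L" using 2 surj by simp
      then have "N v \<inter> S \<noteq> {}" using unsat_N[OF 2] by auto
      moreover have "N v \<inter> S = N v \<inter> Ends"
      proof
        show "N v \<inter> S \<subseteq> N v \<inter> Ends" using unsat_N[OF 2] L_Ends by auto
        show "N v \<inter> Ends \<subseteq> N v \<inter> S" using X_nEnd N_imp_V(1) V_eq by (auto simp: S_def)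
      qed
      ultimately show ?thesis by (auto simp: demand_def Pen_iff)
    next
      case 3
      \<comment> \<open>Both branches of \<open>demand\<close> give 1: if \<open>v\<close> is
        penultimate, then \<open>f v\<close> is an end-vertex and the component is
        \<open>K2\<close>.\<close>
      then have "N v = {f v}" "f v \<in> S" using L_N fL by (auto simp: S_def)
      then show ?thesis by (auto simp: demand_def Pen_iff)
    qed
  qed
  have VS: "V - S = X" using V_eq XY L(2) by (auto simp: S_def)
  have "tight S"
    using dem X_NY X_card VS by (auto simp: tight_def S_def Int_absorb2 le_supI1)
  moreover have "double_dominating_set V E S"
    unfolding double_dominating_set_def closed_neighborhood_def
  proof (intro conjI ballI)
    show "S \<subseteq> V" by (auto simp: S_def V_eq)
    fix v assume vV: "v \<in> V"
    show "2 \<le> card (insert v (N v) \<inter> S)"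
    proof (cases "v \<in> S")
      case True
      have "card (insert v (N v) \<inter> S) = Suc (card (N v \<inter> S))"
        using True finite_N N_irrefl[of v] by simp
      moreover have "card (N v \<inter> S) > 0"
        unfolding card_gt_0_iff using dem[OF True] finite_N by blast
      ultimately show ?thesis by simp
    next
      case False
      then have "v \<in> X" using vV VS by auto
      then have "N v \<inter> S = N v" "card (N v) = 2" using X_NY X_card by (auto simp: S_def)
      then show ?thesis using False by simp
    qed
  qed
  ultimately show thesis using that by blast
qed

section \<open>Attainment of the minimum and conclusion\<close>

text \<open>Makes the set under \<open>Min\<close> nonempty, so that the double domination number is
  attained.\<close>

lemma double_dominating_V:
  assumes "no_isolated_vertices V E"
  shows "double_dominating_set V E V"
  unfolding double_dominating_set_def closed_neighborhood_def
proof (intro conjI ballI)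
  fix v assume v: "v \<in> V"
  have "0 < card (N v)" using assms v by (simp add: no_isolated_vertices_def vertex_degree_def)
  moreover have "insert v (N v) \<inter> V = insert v (N v)" using v N_subset by auto
  ultimately show "2 \<le> card (insert v (N v) \<inter> V)" using finite_N[of v] N_irrefl[of v] by (simp add: Suc_le_eq)
qed simp

lemma double_domination_number_attained:
  assumes "no_isolated_vertices V E"
  obtains S where "double_dominating_set V E S" "card S = double_domination_number V E"
    "\<And>T. double_dominating_set V E T \<Longrightarrow> double_domination_number V E \<le> card T"
proof -
  let ?A = "{card S | S. double_dominating_set V E S}"
  have "?A \<subseteq> card ` Pow V" by (auto simp: double_dominating_set_def)
  then have fin: "finite ?A" using finite_V finite_subset by blast
  have "?A \<noteq> {}" using double_dominating_V[OF assms] by blast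
  then have "double_domination_number V E \<in> ?A"
    unfolding double_domination_number_def by (rule Min_in[OF fin])
  moreover have "double_domination_number V E \<le> card T" if "double_dominating_set V E T" for T
    unfolding double_domination_number_def using that by (intro Min_le[OF fin]) blast
  ultimately show thesis using that by auto
qed

end

theorem theorem3:
  fixes V :: "'a set" and E :: "'a set set" and n m e p :: nat
  assumes "simple_graph V E"
    and "no_isolated_vertices V E"
    and "n = card V"
    and "m = card E"
    and "e = card (end_vertices V E)"
    and "p = card (penultimate_vertices V E)"
  shows "real (double_domination_number V E) \<ge> (4 * real n - 2 * real m + real e - real p) / 3
       \<and> (real (double_domination_number V E) = (4 * real n - 2 * real m + real e - real p) / 3
          \<longleftrightarrow> (V, E) \<in> Omega)"
proof -
  interpret finite_simple_graph V E by unfold_locales (rule assms(1))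
  let ?g = "double_domination_number V E"
  obtain S where S: "double_dominating_set V E S" "card S = ?g"
    and least: "\<And>T. double_dominating_set V E T \<Longrightarrow> ?g \<le> card T"
    using double_domination_number_attained[OF assms(2)] by blast
  have bound: "4 * n + e \<le> 2 * m + 3 * ?g + p"
    using double_dominating_bound(1)[OF S(1)] S(2) assms(3-6) by simp
  have "4 * n + e = 2 * m + 3 * ?g + p \<longleftrightarrow> (V, E) \<in> Omega"
  proof
    assume "4 * n + e = 2 * m + 3 * ?g + p"
    then have "tight S" using double_dominating_bound(2)[OF S(1)] S(2) assms(3-6) by simp
    then show "(V, E) \<in> Omega" using tight_in_Omega[OF S(1)] by blast
  next
    assume "(V, E) \<in> Omega"
    then obtain T where T: "double_dominating_set V E T" "tight T"
      by (rule Omega_imp_tight)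
    then have "4 * n + e = 2 * m + 3 * card T + p"
      using double_dominating_bound(2)[OF T(1)] assms(3-6) by simp
    \<comment> \<open>The tight set \<open>T\<close> meets the lower bound that also holds for
      \<open>?g\<close>, and \<open>?g \<le> card T\<close>; hence
      \<open>?g = card T\<close>.\<close>
    then show "4 * n + e = 2 * m + 3 * ?g + p" using bound least[OF T(1)] by linarith
  qed
  moreover have "real ?g = (4 * real n - 2 * real m + real e - real p) / 3
      \<longleftrightarrow> 4 * n + e = 2 * m + 3 * ?g + p"
    by (auto simp: field_simps)
  ultimately show ?thesis using bound by (simp add: field_simps)
qed

end
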